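(* Let $a,b,q\in\mathbb{C}$ with $|q|<1$, $b\neq 0$, and $a^2q^{m}\ne b$ for every integer $m\ge 1$. Then $$\sum_{r=0}^{\infty} \frac{(1+aq^{r})(a^2;q)_{r}(b;q)_{r}\left(-a/b\right)^r q^{r(r+1)/2}}{(a^2q/b;q)_{r}(q;q)_{r}} = \frac{(-a;q)_{\infty}(a^2q;q^2)_{\infty}(aq/b;q)_{\infty}}{(a^2q/b;q)_{\infty}}.$$
   Context: For $|q|<1$, $x\in\mathbb{C}$ and an integer $n\ge 0$: $(x;q)_n=\prod_{j=0}^{n-1}(1-xq^j)$ (so $(x;q)_0=1$) and $(x;q)_\infty=\prod_{j=0}^{\infty}(1-xq^j)$. The same notation is used with base $q^2$ in place of $q$. *)

theory Defs
  imports "HOL-Analysis.Analysis"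
begin

text \<open>The \<open>q\<close>-shifted factorials \<open>(x;q)\<^sub>n\<close> and \<open>(x;q)\<^sub>\<infinity>\<close>. The infinite product is meant for
  \<open>norm q < 1\<close>, where it converges; as usual for \<^const>\<open>prodinf\<close>, it is \<open>0\<close> if some factor vanishes.\<close>

definition qpoch :: "complex \<Rightarrow> complex \<Rightarrow> nat \<Rightarrow> complex" where
  "qpoch x q n = (\<Prod>j<n. 1 - x * q ^ j)"

definition qpoch_inf :: "complex \<Rightarrow> complex \<Rightarrow> complex" where
  "qpoch_inf x q = (\<Prod>j. 1 - x * q ^ j)"

end

theory Submission
  imports Defs
begin

text \<open>Denote the sum by \<open>F(a)\<close>. The difference of the summands of \<open>F(a)\<close> and of \<open>C(a) F(aq)\<close>, where
  \[C(a) = \frac{(1+a)(1-a^2q)(1-aq/b)}{(1-a^2q/b)(1-a^2q^2/b)},\]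
  telescopes (a Wilf--Zeilberger certificate), so that \<open>F(a) = C(a) F(aq)\<close>. Iterating this and letting
  \<open>F(aq\<^sup>n) \<rightarrow> F(0) = 1\<close> by dominated convergence turns the product of the factors \<open>C(aq\<^sup>k)\<close> into the
  right-hand side.\<close>

section \<open>Shifted factorials: recursions, convergence and bounds from both sides\<close>

lemma qpoch_0 [simp]: "qpoch x q 0 = 1"
  by (simp add: qpoch_def)

lemma qpoch_Suc: "qpoch x q (Suc n) = qpoch x q n * (1 - x * q ^ n)"
  by (simp add: qpoch_def)

lemma qpoch_add: "qpoch x q (m + n) = qpoch x q m * qpoch (x * q ^ m) q n"
  by (induction n) (simp_all add: qpoch_Suc power_add mult_ac)

lemma qpoch_Suc_left: "qpoch x q (Suc n) = (1 - x) * qpoch (x * q) q n"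
  using qpoch_add[of x q 1 n] by (simp add: qpoch_Suc)

lemma qpoch_0_left [simp]: "qpoch 0 q n = 1"
  by (simp add: qpoch_def)

lemma qpoch_nonzero: "(\<And>j. x * q ^ j \<noteq> 1) \<Longrightarrow> qpoch x q n \<noteq> 0"
  by (auto simp: qpoch_def)

lemma q_power_neq_1:
  fixes q :: complex
  assumes "norm q < 1"
  shows "q * q ^ j \<noteq> 1"
proof -
  have "norm (q * q ^ j) < 1"
    using assms power_less_one_iff[of "norm q" "Suc j"] by (simp add: norm_mult norm_power)
  then show ?thesis by auto
qed

lemma qpoch_q_nonzero: "norm q < 1 \<Longrightarrow> qpoch q q n \<noteq> 0"
  by (intro qpoch_nonzero q_power_neq_1)

lemma abs_convergent_qpoch:
  fixes x q :: complex
  assumes "norm q < 1"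
  shows "abs_convergent_prod (\<lambda>j. 1 - x * q ^ j)"
  unfolding abs_convergent_prod_conv_summable
  using assms by (simp add: norm_mult norm_power summable_mult summable_geometric)

lemma qpoch_tendsto:
  assumes "norm q < 1"
  shows "(\<lambda>n. qpoch x q n) \<longlonglongrightarrow> qpoch_inf x q"
proof -
  have "(\<lambda>n. \<Prod>j\<le>n. 1 - x * q ^ j) \<longlonglongrightarrow> qpoch_inf x q"
    unfolding qpoch_inf_def
    by (intro convergent_prod_LIMSEQ abs_convergent_prod_imp_convergent_prod
        abs_convergent_qpoch assms)
  then have "(\<lambda>n. qpoch x q (Suc n)) \<longlonglongrightarrow> qpoch_inf x q"
    by (simp add: qpoch_def lessThan_Suc_atMost)
  then show ?thesis by (simp add: filterlim_sequentially_Suc)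
qed

lemma qpoch_inf_nonzero:
  assumes "norm q < 1" "\<And>j. x * q ^ j \<noteq> 1"
  shows "qpoch_inf x q \<noteq> 0"
  unfolding qpoch_inf_def
  by (rule prodinf_nonzero[OF abs_convergent_prod_imp_convergent_prod[OF abs_convergent_qpoch]])
     (use assms in auto)

text \<open>The inequality \<open>1 + t \<le> exp t\<close> turns the product into the exponential
  of a geometric sum. The bound depends on \<open>x\<close> only through \<open>R\<close>, so one
  constant serves all arguments \<open>(a * q^n)^2\<close>.\<close>

lemma norm_qpoch_le:
  assumes "norm q < 1" "norm x \<le> R"
  shows "norm (qpoch x q n) \<le> exp (R / (1 - norm q))"
proof -
  have R: "R \<ge> 0" using assms(2) norm_ge_zero[of x] by linarith
  have "norm (qpoch x q n) = (\<Prod>j<n. norm (1 - x * q ^ j))"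
    by (simp add: qpoch_def prod_norm)
  also have "\<dots> \<le> (\<Prod>j<n. exp (R * norm q ^ j))"
  proof (intro prod_mono conjI norm_ge_zero)
    fix j
    have "norm (1 - x * q ^ j) \<le> 1 + norm (x * q ^ j)"
      using norm_triangle_ineq4[of 1 "x * q ^ j"] by simp
    also have "\<dots> \<le> 1 + R * norm q ^ j"
      using assms(2) by (simp add: norm_mult norm_power mult_right_mono)
    also have "\<dots> \<le> exp (R * norm q ^ j)" by (rule exp_ge_add_one_self)
    finally show "norm (1 - x * q ^ j) \<le> exp (R * norm q ^ j)" .
  qed
  also have "\<dots> = exp (R * (\<Sum>j<n. norm q ^ j))"
    by (simp add: exp_sum sum_distrib_left)
  also have "\<dots> \<le> exp (R * (1 / (1 - norm q)))"
  proof -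
    have "(\<Sum>j<n. norm q ^ j) \<le> (\<Sum>j. norm q ^ j)"
      by (rule sum_le_suminf) (use assms in \<open>auto intro: summable_geometric\<close>)
    also have "\<dots> = 1 / (1 - norm q)"
      by (rule suminf_geometric) (use assms in auto)
    finally show ?thesis using R by (simp add: mult_left_mono del: times_divide_eq_right)
  qed
  finally show ?thesis by simp
qed

text \<open>The infinite product is nonzero, so the reciprocals converge and are bounded; the
  inverse of such a bound is the required constant.\<close>

lemma qpoch_bounded_below:
  assumes "norm q < 1" "\<And>j. x * q ^ j \<noteq> 1"
  obtains c where "c > 0" "\<And>n. c \<le> norm (qpoch x q n)"
proof -
  have "(\<lambda>n. inverse (qpoch x q n)) \<longlonglongrightarrow> inverse (qpoch_inf x q)"
    by (intro tendsto_inverse qpoch_tendsto qpoch_inf_nonzero assms)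
  then have "Bseq (\<lambda>n. inverse (qpoch x q n))"
    by (meson convergentI convergent_imp_Bseq)
  then obtain K where K: "K > 0" "\<And>n. norm (inverse (qpoch x q n)) \<le> K"
    by (auto simp: Bseq_def)
  show ?thesis
  proof
    show "inverse K > 0" using K by simp
    fix n
    have "norm (qpoch x q n) > 0"
      using qpoch_nonzero[of x q n] assms(2) by simp
    then show "inverse K \<le> norm (qpoch x q n)"
      using K(2)[of n] le_imp_inverse_le[of "inverse (norm (qpoch x q n))" K]
      by (simp only: norm_inverse) simp
  qed
qed

text \<open>Consecutive terms have ratio \<open>y * x ^ Suc r\<close>, which tends to 0 however
  large \<open>y\<close> is. Hence \<open>norm (a / b)\<close> may be arbitrary later on.\<close>

lemma summable_power_triangular:
  fixes x y :: real
  assumes "0 \<le> x" "x < 1" "0 \<le> y"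
  shows "summable (\<lambda>r. y ^ r * x ^ (r * (r + 1) div 2))"
proof -
  have "(\<lambda>r. y * x ^ Suc r) \<longlonglongrightarrow> y * 0"
    using assms by (intro tendsto_mult tendsto_const LIMSEQ_Suc LIMSEQ_realpow_zero) auto
  then have "eventually (\<lambda>r. y * x ^ Suc r < 1 / 2) sequentially"
    by (rule order_tendstoD) simp
  then obtain N where N: "\<And>r. r \<ge> N \<Longrightarrow> y * x ^ Suc r < 1 / 2"
    by (auto simp: eventually_sequentially)
  show ?thesis
  proof (rule summable_ratio_test[of "1 / 2" N])
    fix r assume "r \<ge> N"
    have e: "Suc r * (Suc r + 1) div 2 = r * (r + 1) div 2 + Suc r" by simp
    have "norm (y ^ Suc r * x ^ (Suc r * (Suc r + 1) div 2)) =
          (y * x ^ Suc r) * (y ^ r * x ^ (r * (r + 1) div 2))"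
      unfolding e power_add using assms by (simp add: mult_ac)
    also have "\<dots> \<le> 1 / 2 * (y ^ r * x ^ (r * (r + 1) div 2))"
      using N[OF \<open>r \<ge> N\<close>] assms by (intro mult_right_mono) auto
    finally show "norm (y ^ Suc r * x ^ (Suc r * (Suc r + 1) div 2)) \<le>
        1 / 2 * norm (y ^ r * x ^ (r * (r + 1) div 2))"
      using assms by simp
  qed simp
qed

section \<open>The summand, its certificate and the telescoping sum\<close>

definition qterm :: "complex \<Rightarrow> complex \<Rightarrow> complex \<Rightarrow> nat \<Rightarrow> complex" where
  "qterm a b q r = ((1 + a * q^r) * qpoch (a^2) q r * qpoch b q r * (- a / b)^r
              * q^(r * (r + 1) div 2))
            / (qpoch (a^2 * q / b) q r * qpoch q q r)"

definition qratio :: "complex \<Rightarrow> complex \<Rightarrow> complex \<Rightarrow> complex" where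
  "qratio a b q = (1 + a) * (1 - a^2 * q) * (1 - a * q / b) /
     ((1 - a^2 * q / b) * (1 - a^2 * q^2 / b))"

text \<open>This is \<open>qterm a b q (Suc n)\<close> times a rational function of
  \<open>q ^ Suc n\<close>, multiplied out so that the factors \<open>1 - a\<close> and
  \<open>1 + a * q ^ Suc n\<close>, which may vanish, do not appear as denominators.\<close>

definition qcert :: "complex \<Rightarrow> complex \<Rightarrow> complex \<Rightarrow> nat \<Rightarrow> complex" where
  "qcert a b q n = ((1 + a) * qpoch (a^2 * q) q n * qpoch b q (Suc n) * (- a / b)^Suc n
      * q^(Suc n * (Suc n + 1) div 2) * (a^2 * (1 - a * q / b) * q^Suc n - (1 - a)))
    / (qpoch (a^2 * q / b) q (n + 2) * qpoch q q n)"

lemma den_nonzero: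
  fixes a b q :: complex
  assumes "b \<noteq> 0" "\<And>m::nat. m \<ge> 1 \<Longrightarrow> a^2 * q^m \<noteq> b"
  shows "a^2 * q / b * q ^ j \<noteq> 1"
  using assms(2)[of "Suc j"] assms(1) by (simp add: field_simps)

text \<open>The factors of \<open>qratio\<close> extend the shifted factorials of
  \<open>qterm (a * q) b q r\<close> to the left: one more factor in the numerator, two in the
  denominator. Afterwards they start at the same points as those in \<open>qcert\<close>.\<close>

lemma qratio_qterm:
  "qratio a b q * qterm (a * q) b q r =
    ((1 + a) * (1 - a * q / b) * (1 + a * q^Suc r) * qpoch (a^2 * q) q (Suc r) * qpoch b q r
      * (- a / b)^r * q^r * q^(r * (r + 1) div 2))
    / (qpoch (a^2 * q / b) q (r + 2) * qpoch q q r)"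
proof -
  define c where "c = a^2 * q / b"
  have 1: "qpoch (a^2 * q) q (Suc r) = (1 - a^2 * q) * qpoch ((a * q)^2) q r"
    by (simp add: qpoch_Suc_left power2_eq_square mult_ac)
  have 2: "qpoch c q (r + 2) = (1 - c) * (1 - c * q) * qpoch ((a * q)^2 * q / b) q r"
    by (simp add: qpoch_Suc_left power2_eq_square mult_ac c_def)
  have 3: "(- (a * q) / b) ^ r = (- a / b)^r * q^r"
    by (simp flip: power_mult_distrib)
  have 4: "1 - a^2 * q^2 / b = 1 - c * q"
    by (simp add: c_def power2_eq_square)
  show ?thesis
    unfolding qterm_def qratio_def 3 4 1 c_def[symmetric] 2
    by (simp add: mult_ac)
qed

text \<open>The induction step of the telescoping with all common factors removed and
  \<open>X\<close> standing for \<open>q ^ n\<close>. The four products come, in order, from the two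
  summands at \<open>Suc n\<close> and from \<open>qcert\<close> at \<open>Suc n\<close> and at
  \<open>n\<close>. Encoding \<open>1 / b\<close> as \<open>y\<close> keeps everything
  polynomial.\<close>

lemma certificate_identity:
  fixes a b y q X :: complex
  assumes "b * y = 1"
  shows "(1 + a*q*X) * (1 - a) * (1 - a^2*q*y*q*X) * (1 - a^2*q*y*q^2*X)
      - (1 - a*q*y) * (1 + a*q^2*X) * (1 - a^2*q*X) * (1 - a^2*q^2*X) * (q*X)
    = (1 - a^2*q*X) * (1 - b*q*X) * (- a*y) * (q^2*X) * (a^2*(1 - a*q*y)*(q^2*X) - (1 - a))
      - (1 - q*X) * (1 - a^2*q*y*q^2*X) * (a^2*(1 - a*q*y)*(q*X) - (1 - a))"
  using assms by algebra

lemma qterm_telescope: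
  assumes q: "norm q < 1" and b: "b \<noteq> 0" and m: "\<And>m::nat. m \<ge> 1 \<Longrightarrow> a^2 * q^m \<noteq> b"
  shows "(\<Sum>r\<le>n. qterm a b q r - qratio a b q * qterm (a * q) b q r) = qcert a b q n"
proof (induction n)
  case 0
  define y where "y = 1 / b"
  have yb: "b * y = 1" using b by (simp add: y_def)
  have nz: "1 - a^2*q*y \<noteq> 0" "1 - a^2*q*y*q \<noteq> 0"
    using den_nonzero[OF b m, of 0] den_nonzero[OF b m, of 1] by (auto simp: y_def)
  have y: "z / b = z * y" for z by (simp add: y_def)
  \<comment> \<open>The case \<open>n = 0\<close> after multiplication by the common
    denominator.\<close>
  have "(1 + a) * ((1 - a^2*q*y) * (1 - a^2*q*y*q)) -
     (1 + a) * (1 - a*q*y) * (1 + a*q) * (1 - a^2*q)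
     = (1 + a) * (1 - b) * (- a*y) * q * (a^2 * (1 - a*q*y) * q - (1 - a))"
    using yb by algebra
  then have "qterm a b q 0 - qratio a b q * qterm (a * q) b q 0 = qcert a b q 0"
    unfolding qratio_qterm using nz by (simp add: qterm_def qcert_def y qpoch_Suc divide_simps)
  then show ?case by simp
next
  case (Suc n)
  define y where "y = 1 / b"
  define X where "X = q ^ n"
  define U where "U = qpoch (a^2 * q) q n"
  define V where "V = qpoch b q (Suc n)"
  define W where "W = qpoch (a^2 * q * y) q (Suc n)"
  define Z where "Z = qpoch q q n"
  define L where "L = (- a * y) ^ Suc n"
  define Q where "Q = q ^ (Suc n * (Suc n + 1) div 2)"
  \<comment> \<open>\<open>K\<close> collects what the numerators of all four terms share;
    \<open>d1\<close>, \<open>d2\<close>, \<open>d3\<close> are the factors that complete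
    \<open>W\<close> and \<open>Z\<close> to the largest denominators that occur.\<close>
  define K where "K = (1 + a) * U * V * L * Q"
  define d1 where "d1 = 1 - a^2*q*y*q*X"
  define d2 where "d2 = 1 - a^2*q*y*q^2*X"
  define d3 where "d3 = 1 - q*X"
  have yb: "b * y = 1" using b by (simp add: y_def)
  have y: "z / b = z * y" for z by (simp add: y_def)
  have nz: "d1 \<noteq> 0" "d2 \<noteq> 0" "W \<noteq> 0"
    using den_nonzero[OF b m, of "Suc n"] den_nonzero[OF b m, of "Suc (Suc n)"]
      qpoch_nonzero[OF den_nonzero[OF b m], of "Suc n"]
    by (auto simp: d1_def d2_def W_def X_def y_def power2_eq_square mult_ac)
  have "Z \<noteq> 0" "Z * d3 \<noteq> 0"
    using qpoch_q_nonzero[OF q, of n] qpoch_q_nonzero[OF q, of "Suc n"]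
    by (auto simp: Z_def d3_def X_def qpoch_Suc)
  then have nz': "Z \<noteq> 0" "d3 \<noteq> 0" by auto
  have Q': "q ^ (Suc (Suc n) * (Suc (Suc n) + 1) div 2) = Q * (q^2 * X)"
  proof -
    have "Suc (Suc n) * (Suc (Suc n) + 1) div 2 = Suc n * (Suc n + 1) div 2 + (2 + n)" by simp
    then show ?thesis by (simp only: Q_def X_def power_add)
  qed
  have W1: "qpoch (a^2*q*y) q (Suc n + 2) = W * d1 * d2"
    "qpoch (a^2*q*y) q (n + 2) = W * d1"
    by (simp_all add: W_def d1_def d2_def X_def qpoch_Suc power2_eq_square mult_ac)
  have Z1: "qpoch q q (Suc n) = Z * d3" by (simp add: Z_def d3_def X_def qpoch_Suc)
  have U1: "qpoch (a^2) q (Suc n) = (1 - a^2) * U"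
    "qpoch (a^2*q) q (Suc (Suc n)) = U * (1 - a^2*q*X) * (1 - a^2*q^2*X)"
    "qpoch (a^2*q) q (Suc n) = U * (1 - a^2*q*X)"
    by (simp add: qpoch_Suc_left U_def)
       (simp_all add: U_def X_def qpoch_Suc power2_eq_square mult_ac)
  have V1: "qpoch b q (Suc (Suc n)) = V * (1 - b*q*X)"
    by (simp add: V_def X_def qpoch_Suc mult_ac)
  have L1: "(- a * y) ^ Suc (Suc n) = L * (- a * y)" by (simp add: L_def mult_ac)
  have X1: "q ^ Suc n = q * X" "q ^ Suc (Suc n) = q^2 * X"
    by (simp_all add: X_def power2_eq_square)
  \<comment> \<open>All four terms are brought to the form \<open>K\<close> times a polynomial over
    this common denominator.\<close>
  let ?D = "W * d1 * d2 * (Z * d3)"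
  have t: "qterm a b q (Suc n) = K * ((1 + a*q*X) * (1 - a) * d1 * d2) / ?D"
    unfolding qterm_def y U1 Z1 X1 V_def[symmetric] W_def[symmetric] L_def[symmetric] Q_def[symmetric]
    using nz nz' by (simp add: K_def divide_simps) algebra
  have t': "qratio a b q * qterm (a * q) b q (Suc n)
      = K * ((1 - a*q*y) * (1 + a*q^2*X) * (1 - a^2*q*X) * (1 - a^2*q^2*X) * (q*X)) / ?D"
    unfolding qratio_qterm y U1 Z1 X1 W1 V_def[symmetric] L_def[symmetric] Q_def[symmetric]
    by (simp add: K_def mult_ac)
  have g: "qcert a b q n = K * (d3 * d2 * (a^2*(1 - a*q*y)*(q*X) - (1 - a))) / ?D"
    unfolding qcert_def y X1 W1 V_def[symmetric] L_def[symmetric] Q_def[symmetric]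
      U_def[symmetric] Z_def[symmetric]
    using nz nz' by (simp add: K_def divide_simps)
  have g': "qcert a b q (Suc n) = K * ((1 - a^2*q*X) * (1 - b*q*X) * (- a*y) * (q^2*X) *
      (a^2*(1 - a*q*y)*(q^2*X) - (1 - a))) / ?D"
    unfolding qcert_def y X1 W1 U1 V1 L1 Z1 Q'
    by (simp add: K_def mult_ac)
  have "qterm a b q (Suc n) - qratio a b q * qterm (a * q) b q (Suc n)
      = qcert a b q (Suc n) - qcert a b q n"
    unfolding t t' g g' diff_divide_distrib[symmetric] right_diff_distrib[symmetric]
      certificate_identity[OF yb, of a q X, folded d1_def d2_def d3_def] ..
  then show ?case using Suc by simp
qed

section \<open>Domination, summability and decay of the certificate\<close>

text \<open>The bound is uniform in \<open>n\<close>; this is what dominated convergence along \<open>a q\<^sup>n\<close> needs.\<close>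

lemma norm_qterm_le:
  assumes q: "norm q < 1" and b: "b \<noteq> 0" and m: "\<And>m::nat. m \<ge> 1 \<Longrightarrow> a^2 * q^m \<noteq> b"
  obtains K where "\<And>n r. norm (qterm (a * q^n) b q r)
    \<le> K * (norm (a / b) ^ r * norm q ^ (r * (r + 1) div 2))"
proof -
  define B where "B x = exp (norm (x::complex) / (1 - norm q))" for x
  obtain c where c: "c > 0" "\<And>n. c \<le> norm (qpoch (a^2 * q / b) q n)"
    using qpoch_bounded_below[OF q den_nonzero[OF b m]] by blast
  obtain d where d: "d > 0" "\<And>n. d \<le> norm (qpoch q q n)"
    using qpoch_bounded_below[OF q q_power_neq_1[OF q]] by blast
  \<comment> \<open>The factorial starting at \<open>(a * q^n)^2 * q / b\<close> is the quotient of
    two factorials starting at \<open>a^2 * q / b\<close>, of lengths \<open>n * 2 + r\<close> and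
    \<open>n * 2\<close>. Bounding the first below by \<open>c\<close> and the second above by
    \<open>B\<close> gives a lower bound free of \<open>n\<close>.\<close>
  define c' where "c' = c / B (a^2 * q / b)"
  have c': "c' > 0" using c by (simp add: c'_def B_def)
  have qn: "norm q ^ n \<le> 1" for n using q by (simp add: power_le_one)
  have "norm (qterm (a * q^n) b q r) \<le> ((1 + norm a) * B (a^2) * B b / (c' * d)) *
      (norm (a / b) ^ r * norm q ^ (r * (r + 1) div 2))" for n r
  proof -
    have 1: "norm (1 + a * q^n * q^r) \<le> 1 + norm a"
    proof -
      have "norm (1 + a * q^n * q^r) \<le> 1 + norm (a * q^n * q^r)"
        using norm_triangle_ineq[of 1 "a * q^n * q^r"] by simp
      also have "norm (a * q^n * q^r) = norm a * norm q ^ (n + r)"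
        by (simp add: norm_mult norm_power power_add)
      also have "\<dots> \<le> norm a" using mult_left_le[OF qn[of "n + r"], of "norm a"] by simp
      finally show ?thesis by simp
    qed
    have "norm ((a * q^n)^2) = norm (a^2) * norm q ^ (n * 2)"
      by (simp add: norm_mult norm_power power_mult_distrib power_mult)
    also have "\<dots> \<le> norm (a^2)" using mult_left_le[OF qn[of "n * 2"], of "norm (a^2)"] by simp
    finally have 2: "norm (qpoch ((a * q^n)^2) q r) \<le> B (a^2)"
      unfolding B_def by (intro norm_qpoch_le q)
    have 3: "norm (qpoch b q r) \<le> B b"
      unfolding B_def by (intro norm_qpoch_le q order_refl)
    have "norm (- (a * q^n) / b) = norm (a / b) * norm q ^ n"
      by (simp add: norm_mult norm_power norm_divide)
    also have "\<dots> \<le> norm (a / b)" using mult_left_le[OF qn[of n], of "norm (a / b)"] by simp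
    finally have 4: "norm ((- (a * q^n) / b)^r) \<le> norm (a / b) ^ r"
      unfolding norm_power by (intro power_mono) auto
    have 5: "c' \<le> norm (qpoch ((a * q^n)^2 * q / b) q r)"
    proof -
      let ?x = "a^2 * q / b"
      have "qpoch ?x q (n * 2 + r) = qpoch ?x q (n * 2) * qpoch ((a * q^n)^2 * q / b) q r"
        unfolding qpoch_add by (simp add: power_mult_distrib mult_ac flip: power_mult)
      then have "c \<le> norm (qpoch ?x q (n * 2)) * norm (qpoch ((a * q^n)^2 * q / b) q r)"
        using c(2)[of "n * 2 + r"] by (simp add: norm_mult)
      also have "\<dots> \<le> B ?x * norm (qpoch ((a * q^n)^2 * q / b) q r)"
        unfolding B_def by (intro mult_right_mono norm_qpoch_le q order_refl norm_ge_zero)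
      finally show ?thesis by (simp add: c'_def B_def field_simps)
    qed
    have "norm (qterm (a * q^n) b q r) \<le>
        ((1 + norm a) * B (a^2) * B b * norm (a / b) ^ r * norm q ^ (r * (r + 1) div 2)) / (c' * d)"
      unfolding qterm_def norm_divide norm_mult
      unfolding norm_divide[symmetric] norm_power[of q]
      using c' d(1)
      by (intro frac_le mult_mono 1 2 3 4 5 d(2) mult_nonneg_nonneg)
         (auto simp: B_def)
    then show ?thesis by (simp add: mult_ac)
  qed
  then show ?thesis using that by blast
qed

lemma summable_qterm:
  assumes q: "norm q < 1" and b: "b \<noteq> 0" and m: "\<And>m::nat. m \<ge> 1 \<Longrightarrow> a^2 * q^m \<noteq> b"
  shows "summable (qterm a b q)"
proof -
  obtain K where K: "\<And>n r. norm (qterm (a * q^n) b q r)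
    \<le> K * (norm (a / b) ^ r * norm q ^ (r * (r + 1) div 2))"
    using norm_qterm_le[OF q b m] by blast
  have "summable (\<lambda>r. K * (norm (a / b) ^ r * norm q ^ (r * (r + 1) div 2)))"
    by (intro summable_mult summable_power_triangular) (use q in auto)
  \<comment> \<open>The case \<open>n = 0\<close> of the uniform bound is the majorant.\<close>
  then show ?thesis
    by (rule summable_comparison_test'[where N = 0]) (use K[of 0] in simp)
qed

text \<open>All shifted factorials converge, those in the denominator to nonzero limits. The
  remaining power product is a term of a convergent series by
  \<open>summable_power_triangular\<close>, and it forces the limit 0.\<close>

lemma qcert_tendsto_0:
  assumes q: "norm q < 1" and b: "b \<noteq> 0" and m: "\<And>m::nat. m \<ge> 1 \<Longrightarrow> a^2 * q^m \<noteq> b"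
  shows "qcert a b q \<longlonglongrightarrow> 0"
proof -
  have p: "(\<lambda>n. q ^ Suc n) \<longlonglongrightarrow> 0"
    by (intro LIMSEQ_Suc LIMSEQ_power_zero q)
  have "(\<lambda>r. norm (- a / b) ^ r * norm q ^ (r * (r + 1) div 2)) \<longlonglongrightarrow> 0"
    by (intro summable_LIMSEQ_zero summable_power_triangular) (use q in auto)
  then have "(\<lambda>r. norm ((- a / b) ^ r * q ^ (r * (r + 1) div 2))) \<longlonglongrightarrow> 0"
    by (simp only: norm_mult norm_power)
  then have z: "(\<lambda>n. (- a / b) ^ Suc n * q ^ (Suc n * (Suc n + 1) div 2)) \<longlonglongrightarrow> 0"
    by (intro LIMSEQ_Suc) (rule tendsto_norm_zero_cancel)
  have qq: "qpoch_inf q q \<noteq> 0"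
    by (intro qpoch_inf_nonzero q_power_neq_1 q)
  have "(\<lambda>n. (1 + a) * qpoch (a^2 * q) q n * qpoch b q (Suc n) *
       ((- a / b)^Suc n * q^(Suc n * (Suc n + 1) div 2)) *
       (a^2 * (1 - a * q / b) * q^Suc n - (1 - a))
    / (qpoch (a^2 * q / b) q (n + 2) * qpoch q q n)) \<longlonglongrightarrow>
      (1 + a) * qpoch_inf (a^2 * q) q * qpoch_inf b q * 0 *
       (a^2 * (1 - a * q / b) * 0 - (1 - a)) / (qpoch_inf (a^2 * q / b) q * qpoch_inf q q)"
    by (intro tendsto_intros p z qpoch_tendsto[OF q] LIMSEQ_Suc[OF qpoch_tendsto[OF q]]
        LIMSEQ_ignore_initial_segment[OF qpoch_tendsto[OF q]] no_zero_divisors qq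
        qpoch_inf_nonzero[OF q den_nonzero[OF b m]])
  then show ?thesis
    by (simp only: qcert_def[abs_def] mult.assoc mult_zero_left mult_zero_right div_0)
qed

section \<open>The functional equation, its iteration and the passage to the limit\<close>

text \<open>The partial sums of the difference of the two series are \<open>qcert a b q n\<close>,
  which tends to 0.\<close>

lemma suminf_qterm_rec:
  assumes q: "norm q < 1" and b: "b \<noteq> 0" and m: "\<And>m::nat. m \<ge> 1 \<Longrightarrow> a^2 * q^m \<noteq> b"
  shows "suminf (qterm a b q) = qratio a b q * suminf (qterm (a * q) b q)"
proof -
  \<comment> \<open>The parameter \<open>a * q\<close> inherits the hypothesis, with exponent
    \<open>k + 2\<close>.\<close>
  have m': "(a * q)^2 * q^k \<noteq> b" if "k \<ge> 1" for k
    using m[of "k + 2"] by (simp add: power_mult_distrib power2_eq_square mult_ac)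
  have s: "summable (qterm a b q)" "summable (qterm (a * q) b q)"
    by (intro summable_qterm q b; use m m' in blast)+
  have "(\<lambda>r. qterm a b q r - qratio a b q * qterm (a * q) b q r) sums
      (suminf (qterm a b q) - qratio a b q * suminf (qterm (a * q) b q))"
    by (intro sums_diff sums_mult summable_sums s)
  moreover have "(\<lambda>r. qterm a b q r - qratio a b q * qterm (a * q) b q r) sums 0"
    using qcert_tendsto_0[OF q b m] by (simp add: sums_def_le qterm_telescope[OF q b m])
  ultimately show ?thesis using sums_unique2 by fastforce
qed

text \<open>Each \<open>qratio (a * q^n) b q\<close> adds one factor to every factorial in the
  numerator but two to the one in the denominator, hence the length \<open>2 * n\<close> there. The
  squared parameter produces the base \<open>q^2\<close>.\<close>

lemma suminf_qterm_iterate: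
  assumes q: "norm q < 1" and b: "b \<noteq> 0" and m: "\<And>m::nat. m \<ge> 1 \<Longrightarrow> a^2 * q^m \<noteq> b"
  shows "suminf (qterm a b q) =
    qpoch (- a) q n * qpoch (a^2 * q) (q^2) n * qpoch (a * q / b) q n / qpoch (a^2 * q / b) q (2 * n)
      * suminf (qterm (a * q^n) b q)"
proof (induction n)
  case (Suc n)
  have "(a * q^n)^2 * q^k \<noteq> b" if "k \<ge> 1" for k
    using m[of "n * 2 + k"] that by (simp add: power_mult_distrib power_add power_mult mult_ac)
  then have "suminf (qterm (a * q^n) b q) = qratio (a * q^n) b q * suminf (qterm (a * q^Suc n) b q)"
    using suminf_qterm_rec[OF q b, of "a * q^n"] by (simp add: mult_ac)
  moreover have "qratio (a * q^n) b q = (1 - (- a) * q^n) * (1 - a^2 * q * (q^2)^n) *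
      (1 - a * q / b * q^n) /
      ((1 - a^2 * q / b * q ^ (2 * n)) * (1 - a^2 * q / b * q ^ Suc (2 * n)))"
    unfolding qratio_def
    by (simp add: power_mult_distrib power2_eq_square mult_ac flip: power_mult power_add mult_2)
  ultimately show ?case
    unfolding Suc by (simp add: qpoch_Suc mult_ac)
qed simp

lemma suminf_qterm_tendsto:
  assumes q: "norm q < 1" and b: "b \<noteq> 0" and m: "\<And>m::nat. m \<ge> 1 \<Longrightarrow> a^2 * q^m \<noteq> b"
  shows "(\<lambda>n. suminf (qterm (a * q^n) b q)) \<longlonglongrightarrow> 1"
proof -
  obtain K where K: "\<And>n r. norm (qterm (a * q^n) b q r)
    \<le> K * (norm (a / b) ^ r * norm q ^ (r * (r + 1) div 2))"
    using norm_qterm_le[OF q b m] by blast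
  have lim: "(\<lambda>n. qterm (a * q^n) b q r) \<longlonglongrightarrow> qterm 0 b q r" for r
  proof -
    have "isCont (\<lambda>x. qpoch (f x) q r) 0" if "isCont f 0" for f :: "complex \<Rightarrow> complex"
      unfolding qpoch_def by (intro continuous_intros that)
    \<comment> \<open>At \<open>x = 0\<close> the denominator reduces to \<open>qpoch q q r\<close>,
      which is nonzero.\<close>
    then have "isCont (\<lambda>x. qterm x b q r) 0"
      unfolding qterm_def by (intro continuous_intros) (auto simp: b qpoch_q_nonzero[OF q])
    moreover have "(\<lambda>n. a * q^n) \<longlonglongrightarrow> a * 0"
      by (intro tendsto_mult tendsto_const LIMSEQ_power_zero q)
    ultimately show ?thesis using isCont_tendsto_compose by fastforce
  qed
  let ?M = "\<lambda>r. K * (norm (a / b) ^ r * norm q ^ (r * (r + 1) div 2))"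
  have "summable ?M"
    by (intro summable_mult summable_power_triangular) (use q in auto)
  moreover have "eventually (\<lambda>(r, n). norm (qterm (a * q^n) b q r) \<le> ?M r) (sequentially \<times>\<^sub>F sequentially)"
    by (intro always_eventually) (use K in auto)
  ultimately have "(\<lambda>n. suminf (qterm (a * q^n) b q)) \<longlonglongrightarrow> suminf (qterm 0 b q)"
    using tannerys_theorem[of "\<lambda>r n. qterm (a * q^n) b q r", OF lim] by simp
  \<comment> \<open>The power \<open>(- 0 / b) ^ r\<close> kills every term with
    \<open>r > 0\<close>, and the term at \<open>r = 0\<close> is 1.\<close>
  moreover have "suminf (qterm 0 b q) = (\<Sum>r\<in>{0}. qterm 0 b q r)"
    by (rule suminf_finite) (auto simp: qterm_def)
  ultimately show ?thesis by (simp add: qterm_def)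
qed

theorem theorem2p2:
  fixes a b q :: complex
  assumes "norm q < 1"
    and "b \<noteq> 0"
    and "\<And>m::nat. m \<ge> 1 \<Longrightarrow> a^2 * q^m \<noteq> b"
  shows "(\<lambda>r::nat. ((1 + a * q^r) * qpoch (a^2) q r * qpoch b q r * (- a / b)^r
              * q^(r * (r + 1) div 2))
            / (qpoch (a^2 * q / b) q r * qpoch q q r))
         sums
         ((qpoch_inf (- a) q * qpoch_inf (a^2 * q) (q^2) * qpoch_inf (a * q / b) q)
            / qpoch_inf (a^2 * q / b) q)"
proof -
  let ?R = "(qpoch_inf (- a) q * qpoch_inf (a^2 * q) (q^2) * qpoch_inf (a * q / b) q)
            / qpoch_inf (a^2 * q / b) q"
  have q2: "norm (q^2) < 1"
    using assms(1) by (simp add: norm_power power_less_one_iff)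
  \<comment> \<open>The denominator of the iterated formula has length \<open>2 * n\<close>, so its
    limit is taken along a subsequence.\<close>
  have "filterlim (\<lambda>n::nat. 2 * n) sequentially sequentially"
    by (rule filterlim_subseq) (simp add: strict_mono_def)
  then have "(\<lambda>n. qpoch (a^2 * q / b) q (2 * n)) \<longlonglongrightarrow> qpoch_inf (a^2 * q / b) q"
    by (rule filterlim_compose[OF qpoch_tendsto[OF assms(1)]])
  then have "(\<lambda>n. qpoch (- a) q n * qpoch (a^2 * q) (q^2) n * qpoch (a * q / b) q n
      / qpoch (a^2 * q / b) q (2 * n) * suminf (qterm (a * q^n) b q)) \<longlonglongrightarrow> ?R * 1"
    by (intro tendsto_mult tendsto_divide qpoch_tendsto suminf_qterm_tendsto q2 assms
        qpoch_inf_nonzero den_nonzero)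
  \<comment> \<open>By the iterated formula this sequence is constant, so its value equals its
    limit.\<close>
  then have "(\<lambda>n::nat. suminf (qterm a b q)) \<longlonglongrightarrow> ?R"
    by (simp only: suminf_qterm_iterate[OF assms, symmetric] mult_1_right)
  then have "suminf (qterm a b q) = ?R"
    by (rule LIMSEQ_unique[OF tendsto_const])
  then show ?thesis
    using summable_sums[OF summable_qterm[OF assms]] by (simp add: qterm_def[abs_def])
qed

end
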